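(* Let $G$ be a partially ordered abelian group. Then the following are equivalent: (i) $G$ is finitely presented (as a partially ordered abelian group). (ii) $G$ is finitely generated as a group, and $G^+$ is finitely generated as a monoid. (iii) $G$ is finitely generated as a group, $G^+$ is well-founded, and, for every nonempty subset $X$ of $G^+$, the set $\operatorname{Min} X$ is finite. (iv) $G$ is finitely generated as a group, $G^+$ is well-founded, and $\operatorname{Min} G^{++}$ is finite.
   Context: A partially ordered abelian group is an abelian group $G$ with a partial ordering $\leq$ such that $x\leq y$ implies $x+z\leq y+z$ for all $x,y,z\in G$. Put $G^+=\{x\in G\mid x\geq 0\}$ and $G^{++}=G^+\setminus\{0\}$. $G$ is finitely presented if there exists a finite generating subset $\{g_1,\ldots,g_n\}$ of the group $G$ such that $\{\langle x_1,\ldots,x_n\rangle\in\mathbb{Z}^n\mid g_1x_1+\cdots+g_nx_n\geq 0\}$ is a finitely generated submonoid of $\mathbb{Z}^n$. A partially ordered set $P$ is well-founded if every nonempty subset of $P$ has a minimal element. For a subset $X$ of a partially ordered set, $\operatorname{Min} X$ denotes the set of all minimal elements of $X$. $G^+$ and its subsets carry the ordering of $G$. *)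

theory Defs
  imports
    "HOL-Computational_Algebra.Group_Closure"
    "HOL-Library.Function_Algebras"
begin

text \<open>A partially ordered abelian group is a type of class \<^class>\<open>ordered_ab_group_add\<close>: an abelian
  group with a partial (not necessarily total or directed) translation-invariant order.\<close>

definition pos_cone :: "'a::ordered_ab_group_add set" where
  "pos_cone = {x. 0 \<le> x}"

definition strict_pos_cone :: "'a::ordered_ab_group_add set" where
  "strict_pos_cone = pos_cone - {0}"

inductive_set monoid_closure :: "'a::comm_monoid_add set \<Rightarrow> 'a set" for S where
  zero: "0 \<in> monoid_closure S"
| base: "s \<in> S \<Longrightarrow> s \<in> monoid_closure S"
| add: "s \<in> monoid_closure S \<Longrightarrow> t \<in> monoid_closure S \<Longrightarrow> s + t \<in> monoid_closure S"

definition fin_gen_group :: "'a::ab_group_add set \<Rightarrow> bool" where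
  "fin_gen_group H \<longleftrightarrow> (\<exists>S. finite S \<and> group_closure S = H)"

definition fin_gen_monoid :: "'a::comm_monoid_add set \<Rightarrow> bool" where
  "fin_gen_monoid M \<longleftrightarrow> (\<exists>S. finite S \<and> monoid_closure S = M)"

definition int_mult :: "int \<Rightarrow> 'a::ab_group_add \<Rightarrow> 'a" where
  "int_mult k g = (if 0 \<le> k then \<Sum>i<nat k. g else - (\<Sum>i<nat (- k). g))"

text \<open>The group \<open>\<int>\<^sup>n\<close> is represented by the functions \<open>x :: nat \<Rightarrow> int\<close> vanishing outside
  \<open>{..<n}\<close>, with the pointwise addition of \<^theory>\<open>HOL-Library.Function_Algebras\<close>.\<close>

definition int_vectors :: "nat \<Rightarrow> (nat \<Rightarrow> int) set" where
  "int_vectors n = {x. \<forall>i\<ge>n. x i = 0}"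

definition finitely_presented :: "'a::ordered_ab_group_add itself \<Rightarrow> bool" where
  "finitely_presented TYPE('a) \<longleftrightarrow>
     (\<exists>n (g :: nat \<Rightarrow> 'a). group_closure (g ` {..<n}) = UNIV \<and>
        fin_gen_monoid {x \<in> int_vectors n. 0 \<le> (\<Sum>i<n. int_mult (x i) (g i))})"

definition minimal_elements :: "'a::order set \<Rightarrow> 'a set" where
  "minimal_elements X = {m \<in> X. \<forall>x\<in>X. x \<le> m \<longrightarrow> x = m}"

text \<open>The library's well-foundedness of the strict order on a set says that every nonempty
  subset has a minimal element.\<close>

lemma wfp_on_less_iff_minimal_elements:
  fixes P :: "'a::order set"
  shows "wfp_on P (<) \<longleftrightarrow> (\<forall>X\<subseteq>P. X \<noteq> {} \<longrightarrow> minimal_elements X \<noteq> {})"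
proof -
  have "minimal_elements X \<noteq> {} \<longleftrightarrow> (\<exists>z\<in>X. \<forall>y. y < z \<longrightarrow> y \<notin> X)" for X :: "'a set"
    unfolding minimal_elements_def by (auto simp: less_le)
  then show ?thesis
    unfolding wfp_on_iff_ex_minimal by simp
qed

end

theory Submission
  imports Defs "HOL.Modules" "HOL.Topological_Spaces"
begin

text \<open>Dickson's lemma, in the form that every sequence in a finitely generated monoid of positive
  elements has an ascending subsequence, makes the positive cone a well partial order. Conversely,
  in a well-founded cone one may subtract minimal nonzero elements until reaching zero, so these
  elements generate the cone. The monoid of relations of a presentation maps onto the cone, and it
  is generated by lifts of generators of the cone together with the kernel; the kernel is a
  subgroup of \<open>\<int>\<^sup>n\<close>, hence finitely generated.\<close>

section \<open>Closures\<close>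

lemma monoid_closure_mono: "S \<subseteq> T \<Longrightarrow> monoid_closure S \<subseteq> monoid_closure T"
proof
  fix x assume "S \<subseteq> T" "x \<in> monoid_closure S"
  from this(2,1) show "x \<in> monoid_closure T"
    by (induction) (auto intro: monoid_closure.intros)
qed

lemma monoid_closure_subset:
  assumes "S \<subseteq> M" "0 \<in> M" "\<And>x y. x \<in> M \<Longrightarrow> y \<in> M \<Longrightarrow> x + y \<in> M"
  shows "monoid_closure S \<subseteq> M"
proof
  fix x assume "x \<in> monoid_closure S"
  then show "x \<in> M"
    by induction (use assms in auto)
qed

lemma group_closure_subset:
  assumes "S \<subseteq> H" "0 \<in> H" "\<And>x y. x \<in> H \<Longrightarrow> y \<in> H \<Longrightarrow> x - y \<in> H"
  shows "group_closure S \<subseteq> H"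
proof
  fix x assume "x \<in> group_closure S"
  then show "x \<in> H"
    by induction (use assms in auto)
qed

text \<open>This serves in both directions: generators are pushed forward along a homomorphism, and
  a combination of images is lifted to the same combination of preimages.\<close>

lemma monoid_closure_image:
  assumes "additive f"
  shows "monoid_closure (f ` S) = f ` monoid_closure S"
proof
  show "monoid_closure (f ` S) \<subseteq> f ` monoid_closure S"
  proof (rule monoid_closure_subset)
    show "0 \<in> f ` monoid_closure S"
      using additive.zero[OF assms] monoid_closure.zero by (metis imageI)
    show "x + y \<in> f ` monoid_closure S"
      if "x \<in> f ` monoid_closure S" "y \<in> f ` monoid_closure S" for x y
      using that by (auto simp: additive.add[OF assms, symmetric] intro: monoid_closure.add)
  qed (auto intro: monoid_closure.base)
  have "f x \<in> monoid_closure (f ` S)" if "x \<in> monoid_closure S" for x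
    using that
    by induction (auto simp: additive.add[OF assms] additive.zero[OF assms]
        intro: monoid_closure.intros)
  then show "f ` monoid_closure S \<subseteq> monoid_closure (f ` S)"
    by blast
qed

text \<open>The monoid generated by \<open>S\<close> and its negatives is closed under negation,
  hence is a subgroup. A finite set of group generators thus yields a finite set of monoid
  generators of the same group.\<close>

lemma group_closure_eq_monoid_closure:
  "group_closure S = monoid_closure (S \<union> uminus ` S)"
proof
  let ?M = "monoid_closure (S \<union> uminus ` S)"
  have neg: "- x \<in> ?M" if "x \<in> ?M" for x
    using that
  proof induction
    case (add s t)
    then show ?case
      using monoid_closure.add[of "- s" _ "- t"] by (simp add: add.commute)
  qed (auto intro: monoid_closure.intros)
  show "group_closure S \<subseteq> ?M"
  proof (rule group_closure_subset)
    show "x - y \<in> ?M" if "x \<in> ?M" "y \<in> ?M" for x y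
      using monoid_closure.add[OF that(1) neg[OF that(2)]] by simp
  qed (auto intro: monoid_closure.intros)
  show "?M \<subseteq> group_closure S"
    by (rule monoid_closure_subset) (auto intro: group_closure.base group_closure_add)
qed

lemma fin_gen_group_imp_fin_gen_monoid: "fin_gen_group H \<Longrightarrow> fin_gen_monoid H"
  unfolding fin_gen_group_def fin_gen_monoid_def group_closure_eq_monoid_closure
  by (metis finite_UnI finite_imageI)

section \<open>Integer multiples and integer combinations\<close>

lemma int_mult_0 [simp]: "int_mult 0 g = 0"
  by (simp add: int_mult_def)

lemma int_mult_add_1: "int_mult (k + 1) g = int_mult k g + g"
proof (cases "0 \<le> k")
  case True
  then have "nat (k + 1) = Suc (nat k)" by simp
  with True show ?thesis by (simp add: int_mult_def add.commute)
next
  case False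
  then have "nat (- k) = Suc (nat (- (k + 1)))" by simp
  with False show ?thesis by (auto simp add: int_mult_def algebra_simps)
qed

lemma int_mult_1 [simp]: "int_mult 1 g = g"
  using int_mult_add_1[of 0 g] by simp

lemma int_mult_diff_1: "int_mult (k - 1) g = int_mult k g - g"
  using int_mult_add_1[of "k - 1" g] by simp

lemma int_mult_add: "int_mult (k + l) g = int_mult k g + int_mult l g"
proof (induction l rule: int_induct[of _ 0])
  case (step1 l)
  then show ?case
    using int_mult_add_1[of "k + l" g] by (simp add: int_mult_add_1 add.assoc)
next
  case (step2 l)
  then show ?case
    using int_mult_diff_1[of "k + l" g] by (simp add: int_mult_diff_1 algebra_simps)
qed simp

lemma int_mult_fun_apply: "int_mult k x i = k * x i" for x :: "'b \<Rightarrow> int"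
  by (induction k rule: int_induct[of _ 0])
    (simp_all add: int_mult_add_1 int_mult_diff_1 algebra_simps)

lemma int_mult_in_group_closure: "g \<in> group_closure S \<Longrightarrow> int_mult k g \<in> group_closure S"
  by (induction k rule: int_induct[of _ 0])
    (simp_all add: int_mult_add_1 int_mult_diff_1 group_closure_add group_closure.diff)

lemma int_mult_nonneg: "0 \<le> k \<Longrightarrow> 0 \<le> g \<Longrightarrow> 0 \<le> int_mult k g"
  for g :: "'a::ordered_ab_group_add"
  by (simp add: int_mult_def sum_nonneg)

lemma int_mult_left_mono: "k \<le> l \<Longrightarrow> 0 \<le> g \<Longrightarrow> int_mult k g \<le> int_mult l g"
  for g :: "'a::ordered_ab_group_add"
  using int_mult_add[of k "l - k" g] int_mult_nonneg[of "l - k" g] by simp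

text \<open>The homomorphism from \<int>^n sending the unit vectors to the \<open>g i\<close>.
  Coordinates from \<open>n\<close> on are ignored, so it is additive on all functions, without side
  conditions.\<close>

definition int_comb :: "nat \<Rightarrow> (nat \<Rightarrow> 'a::ab_group_add) \<Rightarrow> (nat \<Rightarrow> int) \<Rightarrow> 'a" where
  "int_comb n g x = (\<Sum>i<n. int_mult (x i) (g i))"

lemma additive_int_comb: "additive (int_comb n g)"
  by standard (simp add: int_comb_def int_mult_add sum.distrib)

text \<open>The image of \<int>^n is a subgroup containing every \<open>g i\<close>, as the value at
  a unit vector. So \<open>int_comb n g\<close> is onto when the \<open>g i\<close> generate the
  group.\<close>

lemma group_closure_subset_int_comb:
  "group_closure (g ` {..<n}) \<subseteq> int_comb n g ` int_vectors n"
proof (rule group_closure_subset)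
  show "g ` {..<n} \<subseteq> int_comb n g ` int_vectors n"
  proof (rule image_subsetI)
    fix i assume "i \<in> {..<n}"
    let ?e = "\<lambda>j. if j = i then 1 else 0 :: int"
    have "int_comb n g ?e = (\<Sum>j<n. if j = i then g j else 0)"
      unfolding int_comb_def by (rule sum.cong) auto
    also have "\<dots> = g i"
      using \<open>i \<in> {..<n}\<close> by simp
    finally show "g i \<in> int_comb n g ` int_vectors n"
      using \<open>i \<in> {..<n}\<close> by (intro image_eqI[of _ _ ?e]) (auto simp: int_vectors_def)
  qed
  show "0 \<in> int_comb n g ` int_vectors n"
    using additive.zero[OF additive_int_comb, of n g]
    by (intro image_eqI[of _ _ 0]) (auto simp: int_vectors_def)
  show "x - y \<in> int_comb n g ` int_vectors n"
    if "x \<in> int_comb n g ` int_vectors n" "y \<in> int_comb n g ` int_vectors n" for x y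
    using that
    by (auto simp: additive.diff[OF additive_int_comb, symmetric] int_vectors_def)
qed

text \<open>Induction on \<open>n\<close> through the last coordinate: the last coordinates of
  elements of \<open>K\<close> form a cyclic subgroup of \<int>. One vector realizing its generator,
  together with generators of the part of \<open>K\<close> with last coordinate zero, generates
  \<open>K\<close>. The second hypothesis says that \<open>K\<close> is a subgroup.\<close>

lemma fin_gen_group_subgroup_int_vectors:
  assumes "K \<subseteq> int_vectors n" "group_closure K = K"
  shows "fin_gen_group K"
  using assms
proof (induction n arbitrary: K)
  case 0
  then have "K \<subseteq> {0}"
    by (auto simp: int_vectors_def fun_eq_iff)
  moreover have "0 \<in> K"
    using 0 zero_in_group_closure by metis
  ultimately have "group_closure {} = K"
    by auto
  then show ?case
    unfolding fin_gen_group_def by blast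
next
  case (Suc n)
  have zero: "0 \<in> K" and diff: "\<And>x y. x \<in> K \<Longrightarrow> y \<in> K \<Longrightarrow> x - y \<in> K"
    using Suc.prems(2) zero_in_group_closure group_closure.diff by metis+
  let ?K' = "K \<inter> int_vectors n"
  have "group_closure ?K' = ?K'"
  proof
    show "group_closure ?K' \<subseteq> ?K'"
      using zero diff by (intro group_closure_subset) (auto simp: int_vectors_def)
  qed (auto intro: group_closure.base)
  then obtain S where S: "finite S" "group_closure S = ?K'"
    using Suc.IH[of ?K'] unfolding fin_gen_group_def by auto
  let ?D = "(\<lambda>x. x n) ` K"
  have "group_closure ?D \<subseteq> ?D"
  proof (rule group_closure_subset)
    show "0 \<in> ?D"
      using zero by (intro image_eqI[of _ _ 0]) auto
    show "a - b \<in> ?D" if "a \<in> ?D" "b \<in> ?D" for a b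
    proof -
      from that obtain x y where "x \<in> K" "y \<in> K" "a = x n" "b = y n" by blast
      then show ?thesis
        by (intro image_eqI[of _ _ "x - y"]) (auto intro: diff)
    qed
  qed simp
  \<comment> \<open>The gcd of \<open>?D\<close> lies in the group generated by \<open>?D\<close>,
    which is contained in \<open>?D\<close>, so some element of \<open>K\<close> attains it.\<close>
  then obtain v where v: "v \<in> K" "v n = Gcd ?D"
    using Gcd_in_group_closure[of ?D] by auto
  have "S \<subseteq> K"
    using S(2) by (auto intro: group_closure.base)
  have "group_closure (insert v S) = K"
  proof
    show "group_closure (insert v S) \<subseteq> K"
      using v \<open>S \<subseteq> K\<close> zero diff by (intro group_closure_subset) auto
    show "K \<subseteq> group_closure (insert v S)"
    proof
      fix x assume "x \<in> K"
      then have "Gcd ?D dvd x n" by (auto intro: Gcd_dvd)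
      then obtain k where k: "x n = k * v n"
        using v by (metis dvd_def mult.commute)
      have "int_mult k v \<in> K"
        using int_mult_in_group_closure[of v K k] v Suc.prems(2) by simp
      \<comment> \<open>Subtracting this multiple of \<open>v\<close> cancels coordinate
        \<open>n\<close>, which leaves an element of \<open>?K'\<close>.\<close>
      with \<open>x \<in> K\<close> have "x - int_mult k v \<in> K"
        by (rule diff)
      moreover have "(x - int_mult k v) i = 0" if "n \<le> i" for i
      proof (cases "i = n")
        case True
        with k show ?thesis by (simp add: int_mult_fun_apply)
      next
        case False
        with that have "Suc n \<le> i" by simp
        moreover have "x - int_mult k v \<in> int_vectors (Suc n)"
          using Suc.prems(1) \<open>x - int_mult k v \<in> K\<close> by blast
        ultimately show ?thesis
          unfolding int_vectors_def by blast
      qed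
      ultimately have "x - int_mult k v \<in> group_closure S"
        using S by (simp add: int_vectors_def)
      then have "x - int_mult k v \<in> group_closure (insert v S)"
        using group_closure_subset[of S "group_closure (insert v S)"]
        by (auto intro: group_closure.intros)
      moreover have "int_mult k v \<in> group_closure (insert v S)"
        by (rule int_mult_in_group_closure) (auto intro: group_closure.base)
      ultimately show "x \<in> group_closure (insert v S)"
        using group_closure_add by (metis diff_add_cancel)
    qed
  qed
  then show ?case
    using S(1) unfolding fin_gen_group_def by blast
qed

section \<open>Finite presentations\<close>

lemma finitely_presented_iff:
  "finitely_presented TYPE('a::ordered_ab_group_add) \<longleftrightarrow>
    (\<exists>n (g :: nat \<Rightarrow> 'a). group_closure (g ` {..<n}) = UNIV \<and>
      fin_gen_monoid {x \<in> int_vectors n. 0 \<le> int_comb n g x})"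
  unfolding finitely_presented_def int_comb_def ..

lemma finitely_presented_imp_fin_gen:
  assumes "finitely_presented TYPE('a::ordered_ab_group_add)"
  shows "fin_gen_group (UNIV :: 'a set)" "fin_gen_monoid (pos_cone :: 'a set)"
proof -
  obtain n and g :: "nat \<Rightarrow> 'a" and T where g: "group_closure (g ` {..<n}) = UNIV"
    and T: "finite T" "monoid_closure T = {x \<in> int_vectors n. 0 \<le> int_comb n g x}"
    using assms unfolding finitely_presented_iff fin_gen_monoid_def by blast
  show "fin_gen_group (UNIV :: 'a set)"
    using g unfolding fin_gen_group_def by blast
  have "monoid_closure (int_comb n g ` T) = pos_cone"
    using group_closure_subset_int_comb[of g n]
    by (auto simp: monoid_closure_image[OF additive_int_comb] T(2) g pos_cone_def)
  then show "fin_gen_monoid (pos_cone :: 'a set)"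
    using T(1) unfolding fin_gen_monoid_def by blast
qed

text \<open>The monoid of relations is the preimage of the cone under \<open>int_comb n g\<close>.
  It is generated by lifts of cone generators together with monoid generators of the kernel, a
  subgroup of \<int>^n.\<close>

lemma fin_gen_imp_finitely_presented:
  assumes "fin_gen_group (UNIV :: 'a::ordered_ab_group_add set)"
    and "fin_gen_monoid (pos_cone :: 'a set)"
  shows "finitely_presented TYPE('a)"
proof -
  obtain R :: "'a set" where R: "finite R" "group_closure R = UNIV"
    using assms(1) unfolding fin_gen_group_def by blast
  obtain g :: "nat \<Rightarrow> 'a" and n where g: "group_closure (g ` {..<n}) = UNIV"
    using R finite_imp_nat_seg_image_inj_on[OF R(1)] by (auto simp: lessThan_def)
  obtain S :: "'a set" where S: "finite S" "monoid_closure S = pos_cone"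
    using assms(2) unfolding fin_gen_monoid_def by blast
  interpret additive "int_comb n g"
    by (rule additive_int_comb)
  let ?M = "{x \<in> int_vectors n. 0 \<le> int_comb n g x}"
  let ?K = "{x \<in> int_vectors n. int_comb n g x = 0}"
  have "group_closure ?K = ?K"
  proof
    show "group_closure ?K \<subseteq> ?K"
      by (rule group_closure_subset) (auto simp: int_vectors_def zero diff)
  qed (auto intro: group_closure.base)
  then have "fin_gen_monoid ?K"
    using fin_gen_group_subgroup_int_vectors[of ?K n]
    by (intro fin_gen_group_imp_fin_gen_monoid) auto
  then obtain T where T: "finite T" "monoid_closure T = ?K"
    unfolding fin_gen_monoid_def by blast
  have "S \<subseteq> int_comb n g ` int_vectors n"
    using group_closure_subset_int_comb[of g n] g by auto
  then obtain L where L: "L \<subseteq> int_vectors n" "finite L" "int_comb n g ` L = S"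
    using finite_subset_image[OF S(1)] by metis
  have "monoid_closure (L \<union> T) = ?M"
  proof
    show "monoid_closure (L \<union> T) \<subseteq> ?M"
    proof (rule monoid_closure_subset)
      have "T \<subseteq> ?K"
        using T(2) by (auto intro: monoid_closure.base)
      moreover have "0 \<le> int_comb n g x" if "x \<in> L" for x
        using that L(3) S(2) monoid_closure.base[of "int_comb n g x" S]
        by (auto simp: pos_cone_def)
      ultimately show "L \<union> T \<subseteq> ?M"
        using L(1) by auto
    qed (auto simp: int_vectors_def zero add)
    show "?M \<subseteq> monoid_closure (L \<union> T)"
    proof
      \<comment> \<open>Express the image of \<open>x\<close> by the generators of the cone and lift
        that expression to \<open>y\<close>; then \<open>x - y\<close> lies in the kernel.\<close>
      fix x assume x: "x \<in> ?M"
      then have "int_comb n g x \<in> monoid_closure (int_comb n g ` L)"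
        using S(2) L(3) by (simp add: pos_cone_def)
      then obtain y where y: "y \<in> monoid_closure L" "int_comb n g y = int_comb n g x"
        unfolding monoid_closure_image[OF additive_int_comb] by force
      have "y \<in> int_vectors n"
        using y(1) L(1) monoid_closure_subset[of L "int_vectors n"]
        by (auto simp: int_vectors_def)
      with x y have "x - y \<in> ?K"
        by (auto simp: int_vectors_def diff)
      then have "x - y \<in> monoid_closure (L \<union> T)"
        using T(2) monoid_closure_mono[of T "L \<union> T"] by blast
      moreover have "y \<in> monoid_closure (L \<union> T)"
        using y(1) monoid_closure_mono[of L "L \<union> T"] by blast
      ultimately show "x \<in> monoid_closure (L \<union> T)"
        using monoid_closure.add[of "x - y" _ y] by simp
    qed
  qed
  then show ?thesis
    using g L(2) T(1) unfolding finitely_presented_iff fin_gen_monoid_def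
    by (metis finite_UnI)
qed

section \<open>Dickson's lemma\<close>

lemma ascending_subsequence_nat:
  fixes f :: "nat \<Rightarrow> nat"
  obtains r where "strict_mono r" "mono (\<lambda>i::nat. f (r i))"
proof -
  obtain r where r: "strict_mono r" "monoseq (\<lambda>i. f (r i))"
    using seq_monosub[of f] by blast
  show thesis
  proof (cases "mono (\<lambda>i::nat. f (r i))")
    case False
    then have dec: "antimono (\<lambda>i::nat. f (r i))"
      using r(2) by (simp add: monoseq_iff)
    \<comment> \<open>A monotone subsequence that is not ascending is descending; from an index
      \<open>k\<close> of its least value on it is constant, hence ascending after all.\<close>
    obtain k where k: "\<And>i. f (r k) \<le> f (r i)"
      using ex_has_least_nat[of "\<lambda>_. True" 0 "\<lambda>i. f (r i)"] by auto
    have "f (r (k + i)) = f (r k)" for i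
      using antimonoD[OF dec, of k "k + i"] k[of "k + i"] by simp
    then show thesis
      using r(1) that[of "\<lambda>i. r (k + i)"] by (simp add: strict_mono_def mono_def)
  qed (use r that in blast)
qed

text \<open>Splitting off the multiples of one generator prepares the induction on the generating
  set in Dickson's lemma.\<close>

lemma monoid_closure_insert:
  assumes "x \<in> monoid_closure (insert s S)"
  shows "\<exists>a\<in>monoid_closure S. \<exists>n. x = a + int_mult (int n) s"
  using assms
proof induction
  case zero
  then show ?case
    by (intro bexI[of _ 0] exI[of _ 0]) (auto intro: monoid_closure.zero)
next
  case (base x)
  then show ?case
  proof
    assume "x = s"
    then show ?thesis
      by (intro bexI[of _ 0] exI[of _ 1]) (auto intro: monoid_closure.zero)
  next
    assume "x \<in> S"
    then show ?thesis
      by (intro bexI[of _ x] exI[of _ 0]) (auto intro: monoid_closure.base)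
  qed
next
  case (add x y)
  then obtain a b m n where "a \<in> monoid_closure S" "b \<in> monoid_closure S"
    "x = a + int_mult (int m) s" "y = b + int_mult (int n) s" by blast
  then show ?case
    by (intro bexI[of _ "a + b"] exI[of _ "m + n"])
      (auto simp: int_mult_add algebra_simps intro: monoid_closure.add)
qed

text \<open>Induction on \<open>S\<close>: split each term into a part generated by the smaller set
  and a multiple of \<open>s\<close>. A first extraction makes the parts ascend, a second one also
  the multiplicities. Since \<open>s\<close> is positive, the sums then ascend.\<close>

lemma ascending_subsequence_monoid_closure:
  fixes f :: "nat \<Rightarrow> 'a::ordered_ab_group_add"
  assumes "finite S" "S \<subseteq> pos_cone" "\<And>i. f i \<in> monoid_closure S"
  shows "\<exists>r. strict_mono r \<and> mono (\<lambda>i::nat. f (r i))"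
  using assms
proof (induction S arbitrary: f)
  case empty
  have "monoid_closure {} \<subseteq> {0 :: 'a}"
    by (rule monoid_closure_subset) auto
  then have "f i = 0" for i
    using empty by blast
  then show ?case
    by (intro exI[of _ id]) (simp add: strict_mono_def mono_def)
next
  case (insert s S)
  have "0 \<le> s"
    using insert.prems(1) by (simp add: pos_cone_def)
  have "\<forall>i. \<exists>a n. a \<in> monoid_closure S \<and> f i = a + int_mult (int n) s"
    using monoid_closure_insert[OF insert.prems(2)] by blast
  then obtain a n where a: "\<And>i. a i \<in> monoid_closure S"
    and f: "\<And>i. f i = a i + int_mult (int (n i)) s"
    by metis
  obtain p where p: "strict_mono p" "mono (\<lambda>i::nat. a (p i))"
    using insert.IH[of a] a insert.prems(1) by auto
  obtain q where q: "strict_mono q" "mono (\<lambda>i::nat. n (p (q i)))"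
    using ascending_subsequence_nat[of "\<lambda>i. n (p i)"] by blast
  have "mono (\<lambda>i::nat. f (p (q i)))"
  proof
    fix i j :: nat assume "i \<le> j"
    then have "a (p (q i)) \<le> a (p (q j))"
      using monoD[OF p(2), of "q i" "q j"] strict_mono_less_eq[OF q(1), of i j] by simp
    moreover have "int_mult (int (n (p (q i)))) s \<le> int_mult (int (n (p (q j)))) s"
      using monoD[OF q(2) \<open>i \<le> j\<close>] \<open>0 \<le> s\<close> by (intro int_mult_left_mono) simp_all
    ultimately show "f (p (q i)) \<le> f (p (q j))"
      unfolding f by (rule add_mono)
  qed
  moreover have "strict_mono (\<lambda>i::nat. p (q i))"
    using p(1) q(1) by (simp add: strict_mono_def)
  ultimately show ?case by blast
qed

section \<open>Well-founded cones\<close>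

text \<open>The first two terms of an ascending subsequence suffice. This excludes both infinite
  descending chains and infinite antichains in the cone.\<close>

lemma fin_gen_monoid_good_sequence:
  fixes f :: "nat \<Rightarrow> 'a::ordered_ab_group_add"
  assumes "fin_gen_monoid (pos_cone :: 'a set)" "\<And>i. f i \<in> pos_cone"
  shows "\<exists>i j. i < j \<and> f i \<le> f j"
proof -
  obtain S :: "'a set" where S: "finite S" "monoid_closure S = pos_cone"
    using assms(1) unfolding fin_gen_monoid_def by blast
  then have "S \<subseteq> pos_cone"
    by (auto intro: monoid_closure.base)
  then obtain r where r: "strict_mono r" "mono (\<lambda>i::nat. f (r i))"
    using ascending_subsequence_monoid_closure[of S f] S assms(2) by auto
  then show ?thesis
    using strict_monoD[OF r(1), of 0 1] monoD[OF r(2), of 0 1] by auto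
qed

lemma fin_gen_monoid_imp_wfp_on:
  assumes "fin_gen_monoid (pos_cone :: 'a::ordered_ab_group_add set)"
  shows "wfp_on (pos_cone :: 'a set) (<)"
proof -
  have False if f: "\<And>i. f (Suc i) < f i \<and> f (Suc i) \<in> pos_cone \<and> f i \<in> pos_cone"
    for f :: "nat \<Rightarrow> 'a"
  proof -
    obtain i j where "i < j" "f i \<le> f j"
      using fin_gen_monoid_good_sequence[OF assms, of f] f by blast
    have "f (Suc k) \<le> f k" for k
      using f[of k] by (simp add: less_imp_le)
    then have "f j \<le> f (Suc i)"
      using \<open>i < j\<close> by (rule lift_Suc_antimono_le[OF _ Suc_leI])
    also have "\<dots> < f i"
      using f[of i] by blast
    finally show False
      using \<open>f i \<le> f j\<close> by (blast dest: leD)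
  qed
  then show ?thesis
    \<comment> \<open>Restricting the strict order to the cone gives a relation on the whole type,
      whose well-foundedness means that no infinite descending chain exists.\<close>
    by (subst wfp_on_iff_wfp) (auto simp: wfp_def wf_iff_no_infinite_down_chain)
qed

text \<open>Distinct minimal elements are incomparable, so infinitely many of them would form a
  sequence without any comparable pair of terms.\<close>

lemma fin_gen_monoid_imp_finite_minimal_elements:
  assumes "fin_gen_monoid (pos_cone :: 'a::ordered_ab_group_add set)" "X \<subseteq> (pos_cone :: 'a set)"
  shows "finite (minimal_elements X)"
proof (rule ccontr)
  assume "infinite (minimal_elements X)"
  then obtain f :: "nat \<Rightarrow> 'a" where f: "inj f" "range f \<subseteq> minimal_elements X"
    using infinite_countable_subset by blast
  then have min: "f i \<in> minimal_elements X" for i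
    by blast
  then have "f i \<in> pos_cone" for i
    using assms(2) by (auto simp: minimal_elements_def)
  then obtain i j where "i < j" "f i \<le> f j"
    using fin_gen_monoid_good_sequence[OF assms(1)] by blast
  then have "f i = f j"
    using min[of i] min[of j] by (simp add: minimal_elements_def)
  with f(1) \<open>i < j\<close> show False
    by (auto dest: injD)
qed

text \<open>Well-founded induction: a nonzero \<open>x\<close> in the cone lies above a minimal
  strictly positive \<open>m\<close>, and \<open>x - m\<close> is a smaller element of the
  cone.\<close>

lemma pos_cone_eq_monoid_closure_minimal_elements:
  assumes "wfp_on (pos_cone :: 'a::ordered_ab_group_add set) (<)"
  shows "monoid_closure (minimal_elements strict_pos_cone) = (pos_cone :: 'a set)"
proof
  let ?N = "monoid_closure (minimal_elements (strict_pos_cone :: 'a set))"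
  show "?N \<subseteq> pos_cone"
    by (rule monoid_closure_subset)
      (auto simp: minimal_elements_def strict_pos_cone_def pos_cone_def)
  have "x \<in> ?N" if "x \<in> pos_cone" for x
    using assms that
  proof (induction rule: wfp_on_induct)
    case (less x)
    show ?case
    proof (cases "x = 0")
      case False
      \<comment> \<open>A minimal element of \<open>?Y\<close> is minimal in all of
        \<open>strict_pos_cone\<close>, since whatever lies below it also lies below
        \<open>x\<close>.\<close>
      let ?Y = "{y \<in> strict_pos_cone. y \<le> x}"
      have "x \<in> ?Y"
        using False less.hyps by (simp add: strict_pos_cone_def)
      moreover have "?Y \<subseteq> pos_cone"
        by (auto simp: strict_pos_cone_def)
      ultimately obtain m where m: "m \<in> minimal_elements ?Y"
        using assms unfolding wfp_on_less_iff_minimal_elements by blast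
      then have "m \<in> minimal_elements strict_pos_cone" and mx: "m \<le> x" "0 < m"
        by (auto simp: minimal_elements_def strict_pos_cone_def pos_cone_def less_le
            intro: order_trans)
      then have "m \<in> ?N"
        by (intro monoid_closure.base)
      moreover have "x - m \<in> ?N"
        using mx by (intro less.IH) (simp_all add: pos_cone_def)
      ultimately show ?thesis
        using monoid_closure.add[of "x - m" _ m] by simp
    qed (simp add: monoid_closure.zero)
  qed (use that in simp)
  then show "pos_cone \<subseteq> ?N" by blast
qed

lemma wfp_on_imp_fin_gen_monoid:
  assumes "wfp_on (pos_cone :: 'a::ordered_ab_group_add set) (<)"
    and "finite (minimal_elements (strict_pos_cone :: 'a set))"
  shows "fin_gen_monoid (pos_cone :: 'a set)"
  using assms pos_cone_eq_monoid_closure_minimal_elements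
  unfolding fin_gen_monoid_def by blast

theorem theorem2p3:
  shows
    "(finitely_presented TYPE('a::ordered_ab_group_add) \<longleftrightarrow>
        fin_gen_group (UNIV :: 'a set) \<and> fin_gen_monoid (pos_cone :: 'a set))
     \<and>
     (fin_gen_group (UNIV :: 'a set) \<and> fin_gen_monoid (pos_cone :: 'a set) \<longleftrightarrow>
        fin_gen_group (UNIV :: 'a set) \<and> wfp_on (pos_cone :: 'a set) (<) \<and>
        (\<forall>X. X \<subseteq> (pos_cone :: 'a set) \<and> X \<noteq> {} \<longrightarrow> finite (minimal_elements X)))
     \<and>
     (fin_gen_group (UNIV :: 'a set) \<and> wfp_on (pos_cone :: 'a set) (<) \<and>
        (\<forall>X. X \<subseteq> (pos_cone :: 'a set) \<and> X \<noteq> {} \<longrightarrow> finite (minimal_elements X)) \<longleftrightarrow>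
        fin_gen_group (UNIV :: 'a set) \<and> wfp_on (pos_cone :: 'a set) (<) \<and>
        finite (minimal_elements (strict_pos_cone :: 'a set)))"
proof -
  let ?all = "\<forall>X. X \<subseteq> (pos_cone :: 'a set) \<and> X \<noteq> {} \<longrightarrow> finite (minimal_elements X)"
  have 1: "finitely_presented TYPE('a) \<longleftrightarrow>
      fin_gen_group (UNIV :: 'a set) \<and> fin_gen_monoid (pos_cone :: 'a set)"
    using finitely_presented_imp_fin_gen fin_gen_imp_finitely_presented by metis
  \<comment> \<open>The strict cone may be empty, a case on which \<open>?all\<close> is
    silent.\<close>
  have min: "finite (minimal_elements (strict_pos_cone :: 'a set))" if ?all
  proof (cases "strict_pos_cone = ({} :: 'a set)")
    case True
    then show ?thesis by (simp add: minimal_elements_def)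
  next
    case False
    moreover have "strict_pos_cone \<subseteq> (pos_cone :: 'a set)"
      by (simp add: strict_pos_cone_def)
    ultimately show ?thesis using that by metis
  qed
  have all: ?all if "fin_gen_monoid (pos_cone :: 'a set)"
    using fin_gen_monoid_imp_finite_minimal_elements[OF that] by metis
  \<comment> \<open>The backward direction specializes \<open>?all\<close> to the strict cone, whose
    finitely many minimal elements generate the cone.\<close>
  have 2: "fin_gen_monoid (pos_cone :: 'a set) \<longleftrightarrow> wfp_on (pos_cone :: 'a set) (<) \<and> ?all"
    using all min fin_gen_monoid_imp_wfp_on wfp_on_imp_fin_gen_monoid by metis
  \<comment> \<open>Passing from the single set \<open>strict_pos_cone\<close> back to all subsets
    goes through finite generation of the cone and hence Dickson's lemma.\<close>
  have 3: "wfp_on (pos_cone :: 'a set) (<) \<and> ?all \<longleftrightarrow>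
      wfp_on (pos_cone :: 'a set) (<) \<and> finite (minimal_elements (strict_pos_cone :: 'a set))"
    using all min wfp_on_imp_fin_gen_monoid by metis
  show ?thesis
    unfolding 1 2 3 by (intro conjI refl)
qed

end
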